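(* $(\tilde{\mathbb{I}},\leq_{\mathrm{XY}})$ is a complete lattice.
   Context: $\tilde{\mathbb{I}}=\{\langle\mu,\nu\rangle\in[0,1]^2 \mid \mu+\nu\le 1\}$ is the set of intuitionistic fuzzy values. For $\alpha=\langle\mu_\alpha,\nu_\alpha\rangle\in\tilde{\mathbb{I}}$ put $s(\alpha)=\mu_\alpha-\nu_\alpha$ and $h(\alpha)=\mu_\alpha+\nu_\alpha$. Define $\alpha<_{\mathrm{XY}}\beta$ iff $s(\alpha)<s(\beta)$, or $s(\alpha)=s(\beta)$ and $h(\alpha)<h(\beta)$; $\alpha\leq_{\mathrm{XY}}\beta$ iff $\alpha<_{\mathrm{XY}}\beta$ or $\alpha=\beta$. A lattice is complete if every subset has a supremum and an infimum. *)

theory Defs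
  imports Complex_Main "HOL-Algebra.Complete_Lattice"
begin

definition ifv :: "(real \<times> real) set" where
  "ifv = {(\<mu>, \<nu>). \<mu> \<in> {0..1} \<and> \<nu> \<in> {0..1} \<and> \<mu> + \<nu> \<le> 1}"

definition ifv_score :: "real \<times> real \<Rightarrow> real" where
  "ifv_score \<alpha> = fst \<alpha> - snd \<alpha>"

definition ifv_accuracy :: "real \<times> real \<Rightarrow> real" where
  "ifv_accuracy \<alpha> = fst \<alpha> + snd \<alpha>"

definition less_XY :: "real \<times> real \<Rightarrow> real \<times> real \<Rightarrow> bool" where
  "less_XY \<alpha> \<beta> \<longleftrightarrow>
     ifv_score \<alpha> < ifv_score \<beta> \<or>
     ifv_score \<alpha> = ifv_score \<beta> \<and> ifv_accuracy \<alpha> < ifv_accuracy \<beta>"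

definition le_XY :: "real \<times> real \<Rightarrow> real \<times> real \<Rightarrow> bool" where
  "le_XY \<alpha> \<beta> \<longleftrightarrow> less_XY \<alpha> \<beta> \<or> \<alpha> = \<beta>"

definition ifv_XY :: "(real \<times> real) gorder" where
  "ifv_XY = \<lparr>carrier = ifv, eq = (=), le = le_XY\<rparr>"

end

theory Submission
  imports Defs
begin

text \<open>In the coordinates (score, accuracy) the order is lexicographic, and the fibre of the
  value set over the score \<open>s \<in> {-1..1}\<close> is the interval \<open>{\<bar>s\<bar>..1}\<close>. To find the infimum of a
  nonempty set, take the infimum \<open>s\<close> of its scores: if \<open>s\<close> is attained, the accuracy of the infimum
  is the infimum of the accuracies over \<open>s\<close>; otherwise every point over \<open>s\<close> is a lower bound, and
  the one of accuracy 1 is the greatest.\<close>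

text \<open>Since the components are half the sum and half the difference of accuracy and score,
  both are nonnegative exactly when the absolute score is at most the accuracy.\<close>

lemma ifv_iff:
  "\<alpha> \<in> ifv \<longleftrightarrow> \<bar>ifv_score \<alpha>\<bar> \<le> ifv_accuracy \<alpha> \<and> ifv_accuracy \<alpha> \<le> 1"
  by (cases \<alpha>) (auto simp: ifv_def ifv_score_def ifv_accuracy_def)

lemma ifv_eq_iff:
  "\<alpha> = \<beta> \<longleftrightarrow> ifv_score \<alpha> = ifv_score \<beta> \<and> ifv_accuracy \<alpha> = ifv_accuracy \<beta>"
  by (cases \<alpha>; cases \<beta>) (auto simp: ifv_score_def ifv_accuracy_def)

lemma le_XY_iff:
  "le_XY \<alpha> \<beta> \<longleftrightarrow> ifv_score \<alpha> < ifv_score \<beta> \<or>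
     ifv_score \<alpha> = ifv_score \<beta> \<and> ifv_accuracy \<alpha> \<le> ifv_accuracy \<beta>"
  unfolding le_XY_def less_XY_def ifv_eq_iff by auto

lemma obtain_score_accuracy:
  obtains \<alpha> where "ifv_score \<alpha> = s" "ifv_accuracy \<alpha> = h"
proof
  show "ifv_score ((h + s) / 2, (h - s) / 2) = s" "ifv_accuracy ((h + s) / 2, (h - s) / 2) = h"
    by (simp_all add: ifv_score_def ifv_accuracy_def field_simps)
qed

lemma partial_order_ifv_XY: "partial_order ifv_XY"
  by unfold_locales (auto simp: ifv_XY_def le_XY_iff ifv_eq_iff)

lemma ifv_XY_greatest_lower_bound:
  assumes A: "A \<subseteq> ifv" and ne: "A \<noteq> {}"
  obtains i where "i \<in> ifv" "\<And>a. a \<in> A \<Longrightarrow> le_XY i a"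
    "\<And>b. \<lbrakk>b \<in> ifv; \<And>a. a \<in> A \<Longrightarrow> le_XY b a\<rbrakk> \<Longrightarrow> le_XY b i"
proof -
  define s where "s = Inf (ifv_score ` A)"
  have bounds: "\<bar>ifv_score a\<bar> \<le> ifv_accuracy a" "ifv_accuracy a \<le> 1" if "a \<in> A" for a
    using A that by (auto simp: ifv_iff)
  have bdd: "bdd_below (ifv_score ` A)"
    \<comment> \<open>Scores are at least -1 because their absolute value is bounded by an accuracy,
      hence by 1.\<close>
    by (rule bdd_belowI[of _ "-1"]) (use bounds in force)
  have s_le: "s \<le> ifv_score a" if "a \<in> A" for a
    unfolding s_def by (rule cINF_lower[OF bdd that])
  have le_s: "t \<le> s" if "\<And>a. a \<in> A \<Longrightarrow> t \<le> ifv_score a" for t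
    unfolding s_def by (rule cINF_greatest[OF ne that])
  have s_of_lower: "ifv_score b \<le> s" if "\<And>a. a \<in> A \<Longrightarrow> le_XY b a" for b
    by (rule le_s) (use that in \<open>force simp: le_XY_iff\<close>)
  show thesis
  proof (cases "s \<in> ifv_score ` A")
    case True
    define F where "F = {a \<in> A. ifv_score a = s}"
    define h where "h = Inf (ifv_accuracy ` F)"
    from True have "F \<noteq> {}" by (auto simp: F_def)
    then obtain c where c: "c \<in> F" by blast
    have bddF: "bdd_below (ifv_accuracy ` F)"
      by (rule bdd_belowI[of _ 0]) (use bounds in \<open>force simp: F_def\<close>)
    have h_le: "h \<le> ifv_accuracy a" if "a \<in> F" for a
      unfolding h_def by (rule cINF_lower[OF bddF that])
    have le_h: "t \<le> h" if "\<And>a. a \<in> F \<Longrightarrow> t \<le> ifv_accuracy a" for t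
      unfolding h_def by (rule cINF_greatest[OF \<open>F \<noteq> {}\<close> that])
    obtain i where i: "ifv_score i = s" "ifv_accuracy i = h"
      by (rule obtain_score_accuracy)
    show thesis
    proof
      \<comment> \<open>Every point of \<open>F\<close> has score \<open>s\<close>, so the absolute
        value of \<open>s\<close> bounds all their accuracies from below.\<close>
      have "\<bar>s\<bar> \<le> h" by (rule le_h) (use bounds in \<open>auto simp: F_def\<close>)
      moreover have "h \<le> 1" using h_le[OF c] bounds(2)[of c] c by (simp add: F_def)
      ultimately show "i \<in> ifv" by (simp add: ifv_iff i)
    next
      fix a assume "a \<in> A"
      then show "le_XY i a"
        using s_le[of a] h_le[of a] by (auto simp: le_XY_iff i F_def)
    next
      fix b assume b: "\<And>a. a \<in> A \<Longrightarrow> le_XY b a"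
      \<comment> \<open>Accuracies matter only on a tie: a lower bound with score below
        \<open>s\<close> lies under \<open>i\<close> anyway.\<close>
      have "ifv_accuracy b \<le> h" if "ifv_score b = s"
        by (rule le_h) (use b that in \<open>force simp: F_def le_XY_iff\<close>)
      then show "le_XY b i"
        using s_of_lower[OF b] by (auto simp: le_XY_iff i)
    qed
  next
    case False
    obtain i where i: "ifv_score i = s" "ifv_accuracy i = 1"
      by (rule obtain_score_accuracy)
    show thesis
    proof
      obtain c where c: "c \<in> A" using ne by blast
      have "-1 \<le> s" by (rule le_s) (use bounds in force)
      moreover have "s \<le> 1" using s_le[OF c] bounds[OF c] by linarith
      ultimately show "i \<in> ifv" by (simp add: ifv_iff i)
    next
      fix a assume "a \<in> A"
      \<comment> \<open>As \<open>s\<close> is not attained, the score of \<open>i\<close> is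
        strictly smaller, so its maximal accuracy does no harm.\<close>
      with False have "s \<noteq> ifv_score a" by blast
      then show "le_XY i a"
        using s_le[OF \<open>a \<in> A\<close>] by (simp add: le_XY_iff i)
    next
      fix b assume "b \<in> ifv" and b: "\<And>a. a \<in> A \<Longrightarrow> le_XY b a"
      then show "le_XY b i"
        using s_of_lower[OF b] by (auto simp: le_XY_iff i ifv_iff)
    qed
  qed
qed

theorem theorem4p1:
  shows "complete_lattice ifv_XY"
proof (rule partial_order.complete_lattice_criterion1[OF partial_order_ifv_XY])
  \<comment> \<open>\<open>g\<close> is the pair (1, 0). The criterion asks for a top and infima of
    nonempty sets: a supremum is the infimum of the upper bounds, which the top keeps
    nonempty.\<close>
  obtain g where g: "ifv_score g = 1" "ifv_accuracy g = 1"
    by (rule obtain_score_accuracy)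
  have "greatest ifv_XY g (carrier ifv_XY)"
    by (auto simp: greatest_def ifv_XY_def le_XY_iff ifv_iff g)
  then show "\<exists>g. greatest ifv_XY g (carrier ifv_XY)" ..
next
  fix A assume "A \<subseteq> carrier ifv_XY" "A \<noteq> {}"
  then have A: "A \<subseteq> ifv" "A \<noteq> {}" by (simp_all add: ifv_XY_def)
  obtain i where i: "i \<in> ifv" "\<And>a. a \<in> A \<Longrightarrow> le_XY i a"
    "\<And>b. \<lbrakk>b \<in> ifv; \<And>a. a \<in> A \<Longrightarrow> le_XY b a\<rbrakk> \<Longrightarrow> le_XY b i"
    using ifv_XY_greatest_lower_bound[OF A] by blast
  \<comment> \<open>\<open>Lower\<close> quantifies over the part of \<open>A\<close> inside the
    carrier, which here is all of \<open>A\<close>.\<close>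
  have "Lower ifv_XY A = {b \<in> ifv. \<forall>a\<in>A. le_XY b a}"
    using A unfolding Lower_def ifv_XY_def by force
  with i have "greatest ifv_XY i (Lower ifv_XY A)"
    by (simp add: greatest_def ifv_XY_def)
  then show "\<exists>i. greatest ifv_XY i (Lower ifv_XY A)" ..
qed

end
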